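(* Let $\boldsymbol{s}=(s_1,\ldots,s_n)\in\mathbb{Z}_{\ge1}^n$ and let $(1,\boldsymbol{s})=(1,s_1,\ldots,s_n)\in\mathbb{Z}_{\ge1}^{n+1}$. The $\boldsymbol{s}$-lecture hall polytope $\mathbf{P}_n^{(\boldsymbol{s})}$ is level if and only if the lecture hall polytope $\mathbf{P}_{n+1}^{(1,\boldsymbol{s})}$ is level.
   Context: For $\boldsymbol{s}=(s_1,\ldots,s_n)\in\mathbb{Z}_{\ge1}^n$, the $\boldsymbol{s}$-lecture hall polytope is $$\mathbf{P}_n^{(\boldsymbol{s})}=\left\{\boldsymbol{\lambda}\in\mathbb{R}^n : 0\leq\frac{\lambda_1}{s_1}\leq\cdots\leq\frac{\lambda_n}{s_n}\leq 1\right\},$$ a lattice simplex. Levelness: for a lattice polytope $P\subset\mathbb{R}^n$ with vertex set $V(P)$, $\mathrm{cone}(P)=\mathrm{span}_{\mathbb{R}_{\ge0}}\{(\boldsymbol{v},1):\boldsymbol{v}\in V(P)\}\subset\mathbb{R}^{n+1}$, with relative interior $\mathrm{cone}(P)^\circ$. $P$ is level if the semigroup algebra $k[P]=k[\mathrm{cone}(P)\cap\mathbb{Z}^{n+1}]$ ($k$ an algebraically closed field of characteristic zero, graded by the last coordinate) is level, i.e. its canonical module $k[\mathrm{cone}(P)^\circ\cap\mathbb{Z}^{n+1}]$ is generated by elements of the same degree; equivalently, there are finitely many $\boldsymbol{c}_1,\ldots,\boldsymbol{c}_m\in\mathbb{Z}^{n+1}$, all with the same last coordinate, such that $\bigcup_{i=1}^m\bigl(\boldsymbol{c}_i+(\mathrm{cone}(P)\cap\mathbb{Z}^{n+1})\bigr)=\mathrm{cone}(P)^\circ\cap\mathbb{Z}^{n+1}$.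 *)

theory Defs
  imports
    "HOL-Analysis.Analysis"
    "HOL-Library.Poly_Mapping"
    "HOL-Library.Option_ord"
begin

section \<open>Lecture hall polytopes\<close>

text \<open>
  Coordinates are indexed by a finite linearly ordered type \<open>'n\<close> in place of \<open>{1, \<dots>, n}\<close>.
  The index type \<open>'n option\<close> of \<open>HOL-Library.Option_ord\<close> adds one new least index \<open>None\<close>, so it
  plays the role of \<open>{1, \<dots>, n + 1}\<close>.
\<close>

definition lecture_hall_polytope ::
  "('n::{finite,linorder} \<Rightarrow> nat) \<Rightarrow> (real ^ 'n::{finite,linorder}) set" where
  "lecture_hall_polytope s =
     {x. (\<forall>i. 0 \<le> x $ i / real (s i)) \<and>
         (\<forall>i j. i \<le> j \<longrightarrow> x $ i / real (s i) \<le> x $ j / real (s j)) \<and>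
         (\<forall>i. x $ i / real (s i) \<le> 1)}"

text \<open>The sequence \<open>(a, s\<^sub>1, \<dots>, s\<^sub>n)\<close>.\<close>

definition cons_seq :: "nat \<Rightarrow> ('n \<Rightarrow> nat) \<Rightarrow> 'n option \<Rightarrow> nat" where
  "cons_seq a s i = (case i of None \<Rightarrow> a | Some j \<Rightarrow> s j)"

section \<open>Cones and lattice points\<close>

text \<open>The space \<open>\<real>\<^sup>n\<^sup>+\<^sup>1\<close> around the cone is \<open>(real ^ 'n) \<times> real\<close>; its last coordinate is \<open>snd\<close>.\<close>

definition cone_over :: "(real ^ 'n) set \<Rightarrow> ((real ^ 'n) \<times> real) set" where
  "cone_over P = convex_cone hull ((\<lambda>v. (v, 1)) ` {v. v extreme_point_of P})"

definition lattice_points :: "((real ^ 'n) \<times> real) set" where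
  "lattice_points = {p. (\<forall>i. fst p $ i \<in> \<int>) \<and> snd p \<in> \<int>}"

section \<open>Semigroup algebras and levelness\<close>

text \<open>
  \<open>((real ^ 'n) \<times> real) \<Rightarrow>\<^sub>0 'k\<close> with the convolution product is the algebra of the
  additive group \<open>\<real>\<^sup>n\<^sup>+\<^sup>1\<close> over \<open>'k\<close>; the semigroup algebra consists of its elements supported on
  the semigroup, and the canonical module is an ideal of it.
\<close>

definition supported_on :: "'a set \<Rightarrow> ('a \<Rightarrow>\<^sub>0 'k::zero) set" where
  "supported_on S = {f. Poly_Mapping.keys f \<subseteq> S}"

definition semigroup_algebra :: "(real ^ 'n) set \<Rightarrow> (((real ^ 'n) \<times> real) \<Rightarrow>\<^sub>0 'k::field) set" where
  "semigroup_algebra P = supported_on (cone_over P \<inter> lattice_points)"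

definition canonical_module :: "(real ^ 'n) set \<Rightarrow> (((real ^ 'n) \<times> real) \<Rightarrow>\<^sub>0 'k::field) set" where
  "canonical_module P = supported_on (rel_interior (cone_over P) \<inter> lattice_points)"

definition homogeneous :: "int \<Rightarrow> (((real ^ 'n) \<times> real) \<Rightarrow>\<^sub>0 'k::field) \<Rightarrow> bool" where
  "homogeneous d f \<longleftrightarrow> (\<forall>p \<in> Poly_Mapping.keys f. snd p = of_int d)"

definition generated_submodule :: "'r::comm_ring_1 set \<Rightarrow> 'r set \<Rightarrow> 'r set" where
  "generated_submodule R G =
     {\<Sum>g\<in>F. r g * g | F r. finite F \<and> F \<subseteq> G \<and> (\<forall>g\<in>F. r g \<in> R)}"

definition level :: "'k::{alg_closed_field,field_char_0} itself \<Rightarrow> (real ^ 'n) set \<Rightarrow> bool" where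
  "level (_ :: 'k itself) P \<longleftrightarrow>
     (\<exists>d. \<exists>G :: (((real ^ 'n) \<times> real) \<Rightarrow>\<^sub>0 'k) set.
        G \<subseteq> canonical_module P \<and> (\<forall>g\<in>G. homogeneous d g) \<and>
        generated_submodule (semigroup_algebra P) G = canonical_module P)"

section \<open>Combinatorial form of levelness\<close>

lemma poly_mapping_eq_sum_single:
  "f = (\<Sum>w\<in>Poly_Mapping.keys f. Poly_Mapping.single w (Poly_Mapping.lookup f w))"
proof (rule poly_mapping_eqI)
  fix k
  have "Poly_Mapping.lookup (\<Sum>w\<in>Poly_Mapping.keys f.
      Poly_Mapping.single w (Poly_Mapping.lookup f w)) k =
      (\<Sum>w\<in>Poly_Mapping.keys f. if w = k then Poly_Mapping.lookup f w else 0)"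
    by (simp add: lookup_sum lookup_single when_def)
  also have "\<dots> = Poly_Mapping.lookup f k"
    by (simp add: in_keys_iff)
  finally show "Poly_Mapping.lookup f k = Poly_Mapping.lookup (\<Sum>w\<in>Poly_Mapping.keys f.
      Poly_Mapping.single w (Poly_Mapping.lookup f w)) k" ..
qed

lemma keys_sum_subset:
  "Poly_Mapping.keys (sum b I) \<subseteq> (\<Union>i\<in>I. Poly_Mapping.keys (b i))"
proof
  fix k assume "k \<in> Poly_Mapping.keys (sum b I)"
  then have "(\<Sum>i\<in>I. Poly_Mapping.lookup (b i) k) \<noteq> 0"
    by (simp add: in_keys_iff lookup_sum)
  then obtain i where "i \<in> I" "Poly_Mapping.lookup (b i) k \<noteq> 0"
    using sum.neutral by metis
  then show "k \<in> (\<Union>i\<in>I. Poly_Mapping.keys (b i))"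
    by (auto simp: in_keys_iff)
qed

lemma finite_vec_components:
  assumes "finite A"
  shows "finite {v :: 'a ^ 'n. \<forall>i. v $ i \<in> A}"
proof -
  have "{v :: 'a ^ 'n. \<forall>i. v $ i \<in> A} \<subseteq> vec_lambda ` (UNIV \<rightarrow>\<^sub>E A)"
  proof
    fix v :: "'a ^ 'n" assume "v \<in> {v. \<forall>i. v $ i \<in> A}"
    then show "v \<in> vec_lambda ` (UNIV \<rightarrow>\<^sub>E A)"
      by (intro image_eqI[of _ _ "vec_nth v"]) auto
  qed
  moreover have "finite ((UNIV :: 'n set) \<rightarrow>\<^sub>E A)"
    using assms by (simp add: finite_PiE)
  ultimately show ?thesis
    by (meson finite_imageI finite_subset)
qed

lemma finite_cone_slice:
  fixes P :: "(real ^ 'n) set"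
  assumes "bounded P"
  shows "finite {p \<in> cone_over P \<inter> lattice_points. snd p = t}"
proof -
  obtain B where B: "\<And>x. x \<in> P \<Longrightarrow> norm x \<le> B"
    using assms unfolding bounded_iff by blast
  let ?K = "{p :: (real ^ 'n) \<times> real. norm (fst p) \<le> B * snd p}"
  have "convex_cone ?K"
    unfolding convex_cone_iff
  proof (intro conjI ballI allI impI)
    show "0 \<in> ?K" by simp
  next
    fix x y assume "x \<in> ?K" "y \<in> ?K"
    then show "x + y \<in> ?K"
      using norm_triangle_ineq[of "fst x" "fst y"] by (simp add: algebra_simps)
  next
    fix x and c :: real assume x: "x \<in> ?K" and c: "0 \<le> c"
    then show "c *\<^sub>R x \<in> ?K"
      using mult_left_mono[of "norm (fst x)" "B * snd x" c] by (simp add: algebra_simps)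
  qed
  moreover have "(\<lambda>v. (v, 1)) ` {v. v extreme_point_of P} \<subseteq> ?K"
    using B by (auto simp: extreme_point_of_def)
  ultimately have sub: "cone_over P \<subseteq> ?K"
    unfolding cone_over_def by (intro hull_minimal)
  let ?I = "{a::real. a \<in> \<int> \<and> \<bar>a\<bar> \<le> B * t}"
  have finV: "finite {v :: real ^ 'n. \<forall>i. v $ i \<in> ?I}"
    by (rule finite_vec_components) (rule finite_abs_int_segment)
  have "{p \<in> cone_over P \<inter> lattice_points. snd p = t} \<subseteq> {v :: real ^ 'n. \<forall>i. v $ i \<in> ?I} \<times> {t}"
  proof
    fix p assume p: "p \<in> {p \<in> cone_over P \<inter> lattice_points. snd p = t}"
    then have "norm (fst p) \<le> B * t" using sub by auto
    then have "\<bar>fst p $ i\<bar> \<le> B * t" for i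
      using component_le_norm_cart[of "fst p" i] by linarith
    then show "p \<in> {v :: real ^ 'n. \<forall>i. v $ i \<in> ?I} \<times> {t}"
      using p by (cases p) (auto simp: lattice_points_def)
  qed
  then show ?thesis using finV by (meson finite_SigmaI finite.emptyI finite.insertI finite_subset)
qed

lemma lookup_single_mult_shift:
  fixes g :: "'a::ab_group_add \<Rightarrow>\<^sub>0 'k::field"
  shows "Poly_Mapping.lookup (Poly_Mapping.single s 1 * g) (s + c) = Poly_Mapping.lookup g c"
proof -
  have g: "g = (\<Sum>w\<in>Poly_Mapping.keys g. Poly_Mapping.single w (Poly_Mapping.lookup g w))"
    by (rule poly_mapping_eq_sum_single)
  have "Poly_Mapping.single s 1 * g =
      (\<Sum>w\<in>Poly_Mapping.keys g. Poly_Mapping.single (s + w) (Poly_Mapping.lookup g w))"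
    by (subst (1) g) (simp add: sum_distrib_left mult_single)
  then have "Poly_Mapping.lookup (Poly_Mapping.single s 1 * g) (s + c) =
      (\<Sum>w\<in>Poly_Mapping.keys g. Poly_Mapping.lookup g w when w = c)"
    by (simp add: lookup_sum lookup_single)
  also have "\<dots> = (\<Sum>w\<in>Poly_Mapping.keys g. if w = c then Poly_Mapping.lookup g w else 0)"
    by (simp add: when_def)
  also have "\<dots> = Poly_Mapping.lookup g c"
    by (simp add: in_keys_iff)
  finally show ?thesis .
qed

theorem level_iff:
  fixes P :: "(real ^ 'n) set"
  assumes "bounded P"
  shows "level TYPE('k::{alg_closed_field,field_char_0}) P \<longleftrightarrow>
    (\<exists>C d. finite C \<and> C \<subseteq> lattice_points \<and> (\<forall>c\<in>C. snd c = d) \<and>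
       (\<Union>c\<in>C. (+) c ` (cone_over P \<inter> lattice_points)) = rel_interior (cone_over P) \<inter> lattice_points)"
    (is "_ = ?R")
proof
  let ?S = "cone_over P \<inter> lattice_points" and ?W = "rel_interior (cone_over P) \<inter> lattice_points"
  let ?A = "semigroup_algebra P :: (((real ^ 'n) \<times> real) \<Rightarrow>\<^sub>0 'k) set"
  let ?M = "canonical_module P :: (((real ^ 'n) \<times> real) \<Rightarrow>\<^sub>0 'k) set"
  assume "level TYPE('k) P"
  then obtain d G where G: "G \<subseteq> ?M" "\<And>g. g \<in> G \<Longrightarrow> homogeneous d g"
    and gen: "generated_submodule ?A G = ?M"
    unfolding level_def by blast
  define C where "C = (\<Union>g\<in>G. Poly_Mapping.keys g)"
  have CW: "C \<subseteq> ?W"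
    using G(1) by (auto simp: C_def canonical_module_def supported_on_def)
  have Cd: "\<forall>c\<in>C. snd c = of_int d"
    using G(2) by (auto simp: C_def homogeneous_def)
  have "C \<subseteq> {p \<in> ?S. snd p = of_int d}"
    using CW Cd rel_interior_subset[of "cone_over P"] by blast
  then have "finite C"
    using finite_cone_slice[OF assms] finite_subset by blast
  moreover have "(\<Union>c\<in>C. (+) c ` ?S) = ?W"
  proof (intro equalityI subsetI)
    fix w assume "w \<in> (\<Union>c\<in>C. (+) c ` ?S)"
    then obtain c s where "c \<in> C" and s: "w = c + s" "s \<in> ?S"
      by blast
    then obtain g where "g \<in> G" "c \<in> Poly_Mapping.keys g"
      unfolding C_def by blast
    with s have w: "w = s + c" "s \<in> ?S" "g \<in> G" "c \<in> Poly_Mapping.keys g"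
      by (simp_all add: add.commute)
    have "Poly_Mapping.single s 1 * g \<in> generated_submodule ?A G"
      unfolding generated_submodule_def
      by (rule CollectI, rule exI[of _ "{g}"], rule exI[of _ "\<lambda>_. Poly_Mapping.single s 1"])
         (use w in \<open>auto simp: semigroup_algebra_def supported_on_def\<close>)
    then have "Poly_Mapping.keys (Poly_Mapping.single s 1 * g) \<subseteq> ?W"
      unfolding gen by (auto simp: canonical_module_def supported_on_def)
    moreover have "w \<in> Poly_Mapping.keys (Poly_Mapping.single s 1 * g)"
      using w by (simp add: in_keys_iff lookup_single_mult_shift)
    ultimately show "w \<in> ?W" by blast
  next
    fix w assume w: "w \<in> ?W"
    then have "Poly_Mapping.single w 1 \<in> ?M"
      by (auto simp: canonical_module_def supported_on_def)
    then obtain F r where F: "finite F" "F \<subseteq> G" "\<forall>g\<in>F. r g \<in> ?A"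
      and eq: "Poly_Mapping.single w 1 = (\<Sum>g\<in>F. r g * g)"
      unfolding gen[symmetric] generated_submodule_def by blast
    have "w \<in> Poly_Mapping.keys (\<Sum>g\<in>F. r g * g)"
      unfolding eq[symmetric] by simp
    then obtain g where g: "g \<in> F" "w \<in> Poly_Mapping.keys (r g * g)"
      using keys_sum_subset[of "\<lambda>g. r g * g" F] by blast
    then obtain a b where "w = a + b" "a \<in> Poly_Mapping.keys (r g)" "b \<in> Poly_Mapping.keys g"
      using keys_mult[of "r g" g] by blast
    moreover from this have "a \<in> ?S" "b \<in> C"
      using F g by (auto simp: C_def semigroup_algebra_def supported_on_def)
    ultimately show "w \<in> (\<Union>c\<in>C. (+) c ` ?S)"
      by (intro UN_I[of b] image_eqI[of _ _ a]) (simp_all add: add.commute)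
  qed
  moreover have "C \<subseteq> lattice_points"
    using CW by blast
  ultimately show ?R
    using Cd by (intro exI[of _ C] exI[of _ "of_int d"]) simp
next
  let ?S = "cone_over P \<inter> lattice_points" and ?W = "rel_interior (cone_over P) \<inter> lattice_points"
  let ?A = "semigroup_algebra P :: (((real ^ 'n) \<times> real) \<Rightarrow>\<^sub>0 'k) set"
  let ?M = "canonical_module P :: (((real ^ 'n) \<times> real) \<Rightarrow>\<^sub>0 'k) set"
  assume ?R
  then obtain C d where C: "finite C" "C \<subseteq> lattice_points" "\<forall>c\<in>C. snd c = d"
    and U: "(\<Union>c\<in>C. (+) c ` ?S) = ?W" by blast
  let ?X = "\<lambda>c. Poly_Mapping.single c (1::'k)"
  have "0 \<in> cone_over P"
    unfolding cone_over_def using convex_cone_convex_cone_hull convex_cone_iff by blast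
  then have zS: "0 \<in> ?S" by (simp add: lattice_points_def)
  have CW: "C \<subseteq> ?W"
  proof
    fix c assume "c \<in> C"
    then have "c + 0 \<in> (\<Union>c\<in>C. (+) c ` ?S)" using zS by blast
    then show "c \<in> ?W" using U by simp
  qed
  obtain e :: int where e: "\<forall>c\<in>C. snd c = of_int e"
  proof (cases "C = {}")
    case False
    then obtain c where "c \<in> C" by blast
    then have "d \<in> \<int>" using C by (auto simp: lattice_points_def)
    then show ?thesis using C(3) that by (metis Ints_cases)
  qed (use that in auto)
  have "generated_submodule ?A (?X ` C) = ?M"
  proof (intro equalityI subsetI)
    fix f assume "f \<in> generated_submodule ?A (?X ` C)"
    then obtain F r where F: "finite F" "F \<subseteq> ?X ` C" "\<forall>g\<in>F. r g \<in> ?A"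
      and f: "f = (\<Sum>g\<in>F. r g * g)"
      unfolding generated_submodule_def by blast
    have "Poly_Mapping.keys f \<subseteq> ?W"
    proof
      fix w assume "w \<in> Poly_Mapping.keys f"
      then obtain g where g: "g \<in> F" "w \<in> Poly_Mapping.keys (r g * g)"
        using keys_sum_subset[of "\<lambda>g. r g * g" F] unfolding f by blast
      then obtain a b where ab: "w = a + b" "a \<in> Poly_Mapping.keys (r g)" "b \<in> Poly_Mapping.keys g"
        using keys_mult[of "r g" g] by blast
      obtain c where "c \<in> C" "g = ?X c" using F g by blast
      with ab have "b \<in> C" by simp
      moreover have "a \<in> ?S" using ab g F by (auto simp: semigroup_algebra_def supported_on_def)
      ultimately show "w \<in> ?W" unfolding U[symmetric] using ab(1)
        by (intro UN_I[of b] image_eqI[of _ _ a]) (simp_all add: add.commute)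
    qed
    then show "f \<in> ?M" by (simp add: canonical_module_def supported_on_def)
  next
    fix f assume "f \<in> ?M"
    then have fW: "Poly_Mapping.keys f \<subseteq> ?W" by (simp add: canonical_module_def supported_on_def)
    have "\<forall>w\<in>Poly_Mapping.keys f. \<exists>c\<in>C. w - c \<in> ?S"
    proof
      fix w assume "w \<in> Poly_Mapping.keys f"
      then have "w \<in> (\<Union>c\<in>C. (+) c ` ?S)" using fW U by blast
      then obtain c s where "c \<in> C" "s \<in> ?S" "w = c + s" by blast
      then show "\<exists>c\<in>C. w - c \<in> ?S" by (intro bexI[of _ c]) auto
    qed
    then obtain h where h: "\<And>w. w \<in> Poly_Mapping.keys f \<Longrightarrow> h w \<in> C \<and> w - h w \<in> ?S"
      by metis
    define r where "r c = (\<Sum>w\<in>{w \<in> Poly_Mapping.keys f. h w = c}.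
        Poly_Mapping.single (w - c) (Poly_Mapping.lookup f w))" for c
    have rA: "r c \<in> ?A" if "c \<in> C" for c
    proof -
      have "Poly_Mapping.keys (r c) \<subseteq> ?S"
      proof
        fix p assume "p \<in> Poly_Mapping.keys (r c)"
        then obtain w where "w \<in> Poly_Mapping.keys f" "h w = c"
            "p \<in> Poly_Mapping.keys (Poly_Mapping.single (w - c) (Poly_Mapping.lookup f w))"
          using keys_sum_subset[of "\<lambda>w. Poly_Mapping.single (w - c) (Poly_Mapping.lookup f w)"
              "{w \<in> Poly_Mapping.keys f. h w = c}"] unfolding r_def by blast
        then show "p \<in> ?S" using h[of w] by (simp split: if_splits)
      qed
      then show ?thesis by (simp add: semigroup_algebra_def supported_on_def)
    qed
    have inj: "inj_on ?X C"
    proof (rule inj_onI)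
      fix x y assume "?X x = ?X y"
      then have "Poly_Mapping.keys (?X x) = Poly_Mapping.keys (?X y)" by (rule arg_cong)
      then show "x = y" by simp
    qed
    have "f = (\<Sum>w\<in>Poly_Mapping.keys f. Poly_Mapping.single w (Poly_Mapping.lookup f w))"
      by (rule poly_mapping_eq_sum_single)
    also have "\<dots> = (\<Sum>c\<in>C. \<Sum>w\<in>{w \<in> Poly_Mapping.keys f. h w = c}.
        Poly_Mapping.single w (Poly_Mapping.lookup f w))"
      using h C(1) by (intro sum.group [symmetric]) auto
    also have "\<dots> = (\<Sum>c\<in>C. r c * ?X c)"
      by (simp add: r_def sum_distrib_right mult_single)
    also have "\<dots> = (\<Sum>g\<in>?X ` C. r (the_inv_into C ?X g) * g)"
      by (simp add: sum.reindex[OF inj] the_inv_into_f_f[OF inj] cong: sum.cong)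
    finally have "f = (\<Sum>g\<in>?X ` C. r (the_inv_into C ?X g) * g)" .
    moreover have "\<forall>g\<in>?X ` C. r (the_inv_into C ?X g) \<in> ?A"
      using rA by (auto simp: the_inv_into_f_f[OF inj])
    ultimately show "f \<in> generated_submodule ?A (?X ` C)"
      unfolding generated_submodule_def using C(1)
      by (intro CollectI exI[of _ "?X ` C"] exI[of _ "\<lambda>g. r (the_inv_into C ?X g)"]) simp
  qed
  moreover have "?X ` C \<subseteq> ?M"
    using CW by (auto simp: canonical_module_def supported_on_def)
  moreover have "\<forall>g\<in>?X ` C. homogeneous e g"
    using e by (auto simp: homogeneous_def)
  ultimately show "level TYPE('k) P"
    unfolding level_def by (intro exI[of _ e] exI[of _ "?X ` C"]) simp
qed

end

theory Submission
  imports Defs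
begin

text \<open>
  If \<open>\<lambda>\<^sub>0\<close> is the coordinate belonging to the new entry \<open>1\<close>, then subtracting \<open>\<lambda>\<^sub>0 (1, s, 1)\<close> is a
  unimodular change of coordinates that turns the cone over the polytope of \<open>(1, s)\<close> into the
  product of the cone over the polytope of \<open>s\<close> with the half-line of all \<open>\<lambda>\<^sub>0 \<ge> 0\<close>. On lattice
  points the semigroup gains a free generator of degree one, that is, the semigroup algebra becomes
  a polynomial ring in one variable over the old one, and the interior lattice points
  become those with \<open>\<lambda>\<^sub>0 \<ge> 1\<close> over an old interior point. Generators of the canonical module in one
  degree thus correspond to generators with \<open>\<lambda>\<^sub>0 = 1\<close>, one degree higher.
\<close>

section \<open>Cones over compact convex sets\<close>

lemma convex_cone_cone_over: "convex_cone (cone_over P)"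
  unfolding cone_over_def by (rule convex_cone_convex_cone_hull)

text \<open>The right-hand side is a convex cone containing the generators, because extreme points
  of \<open>P\<close> lie in \<open>P\<close>. Conversely, by Krein-Milman every point of
  \<open>P\<close> is a convex combination of extreme points, so all of \<open>P\<close> at height 1
  lies in the cone. This removes extreme points from the rest of the argument.\<close>

lemma cone_over_eq:
  fixes P :: "(real ^ 'n) set"
  assumes "compact P" "convex P" "P \<noteq> {}"
  shows "cone_over P = {(t *\<^sub>R x, t) | t x. 0 \<le> t \<and> x \<in> P}" (is "_ = ?K")
proof
  have "convex_cone ?K"
    unfolding convex_cone_iff
  proof (intro conjI ballI allI impI)
    obtain x where "x \<in> P" using assms(3) by blast
    then show "0 \<in> ?K"
      by (intro CollectI exI[of _ 0] exI[of _ x]) (simp add: zero_prod_def)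
  next
    fix p q assume "p \<in> ?K" "q \<in> ?K"
    then obtain t x u y where p: "p = (t *\<^sub>R x, t)" "0 \<le> t" "x \<in> P"
      and q: "q = (u *\<^sub>R y, u)" "0 \<le> u" "y \<in> P" by blast
    show "p + q \<in> ?K"
    proof (cases "t + u = 0")
      case True
      then have "t = 0" "u = 0" using p(2) q(2) by auto
      then show ?thesis using p q by auto
    next
      case False
      then have pos: "t + u > 0" using p(2) q(2) by simp
      \<comment> \<open>Averaging \<open>x\<close> and \<open>y\<close> with their heights as
        weights makes the sum a multiple of a single point of \<open>P\<close>. This requires
        nonzero total height, hence the case split.\<close>
      define z where "z = (t / (t + u)) *\<^sub>R x + (u / (t + u)) *\<^sub>R y"
      have "z \<in> P" unfolding z_def
        using p q pos by (intro convexD[OF assms(2)]) (auto simp: add_divide_distrib[symmetric])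
      moreover have "p + q = ((t + u) *\<^sub>R z, t + u)"
        using pos by (simp add: p q z_def scaleR_add_right)
      ultimately show ?thesis using pos by (smt (verit) mem_Collect_eq)
    qed
  next
    fix p and c :: real assume "p \<in> ?K" "0 \<le> c"
    then obtain t x where "p = (t *\<^sub>R x, t)" "0 \<le> t" "x \<in> P" by blast
    then show "c *\<^sub>R p \<in> ?K" using \<open>0 \<le> c\<close>
      by (intro CollectI exI[of _ "c * t"] exI[of _ x]) simp
  qed
  moreover have "(\<lambda>v. (v, 1)) ` {v. v extreme_point_of P} \<subseteq> ?K"
  proof
    fix p assume "p \<in> (\<lambda>v. (v, 1::real)) ` {v. v extreme_point_of P}"
    then obtain v where "v \<in> P" "p = (v, 1)" by (auto simp: extreme_point_of_def)
    then show "p \<in> ?K" by (intro CollectI exI[of _ 1] exI[of _ v]) simp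
  qed
  ultimately show "cone_over P \<subseteq> ?K"
    unfolding cone_over_def by (intro hull_minimal)
next
  have cc: "convex (cone_over P)"
    using convex_cone_cone_over[of P] by (simp add: convex_cone_def)
  \<comment> \<open>This preimage is the slice of the cone at height 1. Being convex, it contains
    the hull of the extreme points as soon as it contains the extreme points.\<close>
  have "convex ((\<lambda>v. (v, 1::real)) -` cone_over P)"
  proof (rule convexI)
    fix x y :: "real ^ 'n" and u v :: real
    assume *: "x \<in> (\<lambda>v. (v, 1)) -` cone_over P" "y \<in> (\<lambda>v. (v, 1)) -` cone_over P"
      "0 \<le> u" "0 \<le> v" "u + v = 1"
    then have "u *\<^sub>R (x, 1) + v *\<^sub>R (y, 1) \<in> cone_over P"
      by (intro convexD[OF cc]) auto
    then show "u *\<^sub>R x + v *\<^sub>R y \<in> (\<lambda>v. (v, 1)) -` cone_over P"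
      using *(5) by simp
  qed
  moreover have "{v. v extreme_point_of P} \<subseteq> (\<lambda>v. (v, 1::real)) -` cone_over P"
    unfolding cone_over_def by (auto intro: hull_inc)
  ultimately have "convex hull {v. v extreme_point_of P} \<subseteq> (\<lambda>v. (v, 1::real)) -` cone_over P"
    by (intro hull_minimal)
  then have "P \<subseteq> (\<lambda>v. (v, 1::real)) -` cone_over P"
    using Krein_Milman_Minkowski[OF assms(1,2)] by simp
  then show "?K \<subseteq> cone_over P"
    using convex_cone_cone_over[of P] by (force simp: convex_cone_iff)
qed

section \<open>Lecture hall polytopes and the inequalities of their cones\<close>

lemma lecture_hall_polytope_bounds:
  assumes "\<And>i. s i \<ge> 1" "x \<in> lecture_hall_polytope s"
  shows "0 \<le> x $ i" "x $ i \<le> real (s i)"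
proof -
  have "0 < real (s i)" using assms(1)[of i] by simp
  moreover have "0 \<le> x $ i / real (s i)" "x $ i / real (s i) \<le> 1"
    using assms(2) unfolding lecture_hall_polytope_def by auto
  ultimately show "0 \<le> x $ i" "x $ i \<le> real (s i)"
    by (simp_all add: zero_le_divide_iff divide_le_eq_1)
qed

lemma compact_lecture_hall_polytope:
  fixes s :: "'n::{finite,linorder} \<Rightarrow> nat"
  assumes "\<And>i. s i \<ge> 1"
  shows "compact (lecture_hall_polytope s)"
proof -
  have "lecture_hall_polytope s \<subseteq> cbox 0 (\<chi> i. real (s i))"
    using lecture_hall_polytope_bounds[OF assms] by (auto simp: mem_box_cart)
  then have "bounded (lecture_hall_polytope s)"
    using bounded_cbox bounded_subset by blast
  moreover have "closed (lecture_hall_polytope s)"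
    unfolding lecture_hall_polytope_def divide_inverse
    by (intro closed_Collect_conj closed_Collect_all closed_Collect_imp closed_Collect_le
          open_Collect_const continuous_intros)
  ultimately show ?thesis by (simp add: compact_eq_bounded_closed)
qed

lemma convex_lecture_hall_polytope: "convex (lecture_hall_polytope s)"
proof (rule convexI)
  fix x y and u v :: real
  assume *: "x \<in> lecture_hall_polytope s" "y \<in> lecture_hall_polytope s"
    "0 \<le> u" "0 \<le> v" "u + v = 1"
  have eq: "(u *\<^sub>R x + v *\<^sub>R y) $ i / real (s i) =
      u * (x $ i / real (s i)) + v * (y $ i / real (s i))" for i
    by (simp add: add_divide_distrib)
  show "u *\<^sub>R x + v *\<^sub>R y \<in> lecture_hall_polytope s"
    unfolding lecture_hall_polytope_def mem_Collect_eq eq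
    using * by (auto simp: lecture_hall_polytope_def intro!: add_mono mult_left_mono
      convex_bound_le add_nonneg_nonneg mult_nonneg_nonneg simp del: times_divide_eq_right)
qed

text \<open>Homogenization: scaling by \<open>t\<close> turns the upper bound 1 into
  \<open>t\<close> and preserves the other inequalities.\<close>

lemma cone_over_lecture_hall_polytope:
  fixes s :: "'n::{finite,linorder} \<Rightarrow> nat"
  assumes "\<And>i. s i \<ge> 1"
  shows "cone_over (lecture_hall_polytope s) =
    {(x, t). (\<forall>i. 0 \<le> x $ i / real (s i)) \<and>
       (\<forall>i j. i \<le> j \<longrightarrow> x $ i / real (s i) \<le> x $ j / real (s j)) \<and>
       (\<forall>i. x $ i / real (s i) \<le> t)}" (is "_ = ?K")
proof -
  have 0: "0 \<in> lecture_hall_polytope s" by (simp add: lecture_hall_polytope_def)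
  have "cone_over (lecture_hall_polytope s) =
      {(t *\<^sub>R x, t) | t x. 0 \<le> t \<and> x \<in> lecture_hall_polytope s}"
    using 0 by (intro cone_over_eq compact_lecture_hall_polytope[OF assms]
      convex_lecture_hall_polytope) auto
  also have "\<dots> = ?K"
  proof (intro equalityI subsetI)
    fix p assume "p \<in> {(t *\<^sub>R x, t) | t x. 0 \<le> t \<and> x \<in> lecture_hall_polytope s}"
    then obtain t x where p: "p = (t *\<^sub>R x, t)" "0 \<le> t" "x \<in> lecture_hall_polytope s" by blast
    have eq: "(t *\<^sub>R x) $ i / real (s i) = t * (x $ i / real (s i))" for i by simp
    show "p \<in> ?K"
      unfolding p(1) mem_Collect_eq case_prod_conv eq
      using p(2,3) by (auto simp: lecture_hall_polytope_def
        intro!: mult_left_mono mult_left_le simp del: times_divide_eq_right)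
  next
    fix p assume pK: "p \<in> ?K"
    obtain x t where p: "p = (x, t)" by (cases p)
    have x: "0 \<le> x $ i / real (s i)" "x $ i / real (s i) \<le> t"
      "i \<le> j \<Longrightarrow> x $ i / real (s i) \<le> x $ j / real (s j)" for i j
      using pK unfolding p by auto
    \<comment> \<open>Any index serves here, as index types are nonempty.\<close>
    have t: "0 \<le> t" using x(1,2) order_trans by blast
    show "p \<in> {(t *\<^sub>R x, t) | t x. 0 \<le> t \<and> x \<in> lecture_hall_polytope s}"
    proof (cases "t = 0")
      case True
      \<comment> \<open>At height 0 each ratio is squeezed between 0 and 0, so only the apex
        remains, and it is 0 times the polytope point 0.\<close>
      have "x $ i = 0" for i
      proof -
        have "x $ i / real (s i) = 0" using x(1,2)[of i] True by simp
        then show ?thesis using assms[of i] by simp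
      qed
      then have "x = 0" by (simp add: vec_eq_iff)
      then show ?thesis using 0 True p by auto
    next
      case False
      then have t: "0 < t" using t by simp
      have eq: "((1 / t) *\<^sub>R x) $ i / real (s i) = (x $ i / real (s i)) / t" for i
        by (simp add: divide_simps)
      have "(1 / t) *\<^sub>R x \<in> lecture_hall_polytope s"
        unfolding lecture_hall_polytope_def mem_Collect_eq eq
        using x t by (auto intro!: divide_right_mono divide_nonneg_pos simp: divide_le_eq_1
          simp del: divide_divide_eq_left)
      then show ?thesis using t p
        by (intro CollectI exI[of _ t] exI[of _ "(1 / t) *\<^sub>R x"]) simp
    qed
  qed
  finally show ?thesis .
qed

section \<open>Levelness and the product of a cone with a half-line\<close>

text \<open>\<open>L\<close> carries cone, lattice and grading of the product to those of
  \<open>Q\<close>, so \<open>level_iff\<close> reduces the claim to generating sets of interior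
  lattice points. One direction places a set \<open>C\<close> for \<open>P\<close> at half-line
  coordinate 1; the other keeps from a set for \<open>Q\<close> only the part at coordinate
  1.\<close>

lemma level_iff_level_of_cone_times_halfline:
  fixes P :: "(real ^ 'n) set" and Q :: "(real ^ 'm) set"
    and L :: "((real ^ 'n) \<times> real) \<times> real \<Rightarrow> (real ^ 'm) \<times> real"
  assumes "bounded P" "bounded Q"
    and L: "linear L" "inj L"
    and cone: "cone_over Q = L ` (cone_over P \<times> {0..})"
    and lattice: "\<And>p m. L (p, m) \<in> lattice_points \<longleftrightarrow> p \<in> lattice_points \<and> m \<in> \<int>"
    and degree: "\<And>p m. snd (L (p, m)) = snd p + m"
  shows "level TYPE('k::{alg_closed_field,field_char_0}) P \<longleftrightarrow> level TYPE('k) Q"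
proof -
  let ?S = "cone_over P \<inter> lattice_points" and ?W = "rel_interior (cone_over P) \<inter> lattice_points"
  let ?S' = "cone_over Q \<inter> lattice_points" and ?W' = "rel_interior (cone_over Q) \<inter> lattice_points"
  have cc: "convex (cone_over P)" and z: "0 \<in> ?S"
    using convex_cone_cone_over[of P]
    by (auto simp: convex_cone_def lattice_points_def convex_cone_contains_0)
  have Lcancel: "L a = L b \<longleftrightarrow> a = b" for a b using L(2) by (simp add: inj_eq)
  have Ladd: "L (p, m) + L (q, k) = L (p + q, m + k)" for p q m k
    using linear_add[OF L(1), of "(p, m)" "(q, k)"] by simp
  have S': "L (p, m) \<in> ?S' \<longleftrightarrow> p \<in> ?S \<and> m \<in> \<int> \<and> 0 \<le> m" for p m
    unfolding cone by (auto simp: lattice inj_image_mem_iff[OF L(2)])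
  \<comment> \<open>Relative interior commutes with injective linear maps and with products of
    convex sets, and the half-line \<open>{0..}\<close> has interior \<open>{0<..}\<close>.\<close>
  have "rel_interior (cone_over Q) = L ` (rel_interior (cone_over P) \<times> {0<..})"
    using L cc unfolding cone
    by (subst rel_interior_injective_linear_image)
      (simp_all add: rel_interior_Times rel_interior_nonempty_interior linear_conv_bounded_linear)
  then have W': "L (p, m) \<in> ?W' \<longleftrightarrow> p \<in> ?W \<and> m \<in> \<int> \<and> 0 < m"
    and W'_cases: "q \<in> ?W' \<Longrightarrow> \<exists>p m. q = L (p, m)" for p m q
    by (auto simp: lattice inj_image_mem_iff[OF L(2)])
  have S'_cases: "q \<in> ?S' \<Longrightarrow> \<exists>p m. q = L (p, m)" for q
    unfolding cone by auto
  have Ints_pos: "1 \<le> m" if "m \<in> \<int>" "0 < m" for m :: real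
    using that by (auto elim!: Ints_cases)
  show ?thesis
    unfolding level_iff[OF assms(1)] level_iff[OF assms(2)]
  proof
    assume "\<exists>C d. finite C \<and> C \<subseteq> lattice_points \<and> (\<forall>c\<in>C. snd c = d) \<and> (\<Union>c\<in>C. (+) c ` ?S) = ?W"
    then obtain C d where C: "finite C" "C \<subseteq> lattice_points" "\<forall>c\<in>C. snd c = d"
      "(\<Union>c\<in>C. (+) c ` ?S) = ?W" by blast
    have "(\<Union>c\<in>(\<lambda>c. L (c, 1)) ` C. (+) c ` ?S') = ?W'"
    proof (intro equalityI subsetI)
      fix w assume "w \<in> (\<Union>c\<in>(\<lambda>c. L (c, 1)) ` C. (+) c ` ?S')"
      then obtain c q where "c \<in> C" "q \<in> ?S'" "w = L (c, 1) + q" by auto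
      moreover from this obtain p m where "q = L (p, m)" using S'_cases by meson
      ultimately have "c \<in> C" "L (p, m) \<in> ?S'" "w = L (c, 1) + L (p, m)" by simp_all
      moreover from this have "c + p \<in> ?W" using C(4) S' by blast
      ultimately show "w \<in> ?W'" unfolding S' Ladd using W'[of "c + p" "1 + m"] by simp
    next
      fix w assume w: "w \<in> ?W'"
      then obtain v m where v: "w = L (v, m)" using W'_cases by meson
      have vm: "v \<in> ?W" "m \<in> \<int>" "1 \<le> m" using w Ints_pos unfolding v W' by simp_all
      then obtain c p where cp: "c \<in> C" "p \<in> ?S" "v = c + p" using C(4) by blast
      \<comment> \<open>The generator uses up 1 of the half-line coordinate; the surplus
        \<open>m - 1\<close> is nonnegative by integrality and goes to the semigroup
        element.\<close>
      then have "L (p, m - 1) \<in> ?S'" unfolding S' using vm by simp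
      moreover have "w = L (c, 1) + L (p, m - 1)" by (simp add: Ladd v cp)
      ultimately show "w \<in> (\<Union>c\<in>(\<lambda>c. L (c, 1)) ` C. (+) c ` ?S')" using cp(1) by blast
    qed
    then show "\<exists>C d. finite C \<and> C \<subseteq> lattice_points \<and> (\<forall>c\<in>C. snd c = d) \<and>
        (\<Union>c\<in>C. (+) c ` ?S') = ?W'"
      using C(1-3) by (intro exI[of _ "(\<lambda>c. L (c, 1)) ` C"] exI[of _ "d + 1"])
        (auto simp: lattice degree)
  next
    assume "\<exists>C d. finite C \<and> C \<subseteq> lattice_points \<and> (\<forall>c\<in>C. snd c = d) \<and> (\<Union>c\<in>C. (+) c ` ?S') = ?W'"
    then obtain C d where C: "finite C" "C \<subseteq> lattice_points" "\<forall>c\<in>C. snd c = d"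
      "(\<Union>c\<in>C. (+) c ` ?S') = ?W'" by blast
    let ?D = "(\<lambda>c. L (c, 1)) -` C"
    have "L (0, 0) \<in> ?S'" unfolding S' using z by simp
    moreover have "L (0, 0) = 0" using linear_0[OF L(1)] by (simp add: zero_prod_def)
    ultimately have "0 \<in> ?S'" by metis
    then have "c \<in> (+) c ` ?S'" for c by (metis add.right_neutral imageI)
    \<comment> \<open>Since 0 is in the semigroup, each generator is itself an interior point; it
      therefore lies in the range of \<open>L\<close> with half-line coordinate at least 1.\<close>
    then have CW: "C \<subseteq> ?W'" using C(4) by blast
    have "(\<Union>c\<in>?D. (+) c ` ?S) = ?W"
    proof (intro equalityI subsetI)
      fix w assume "w \<in> (\<Union>c\<in>?D. (+) c ` ?S)"
      then obtain c p where cp: "L (c, 1) \<in> C" "p \<in> ?S" "w = c + p" by blast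
      then have "L (p, 0) \<in> ?S'" unfolding S' by simp
      then have "L (c, 1) + L (p, 0) \<in> ?W'" using cp(1) C(4) by blast
      then show "w \<in> ?W" using W' by (simp add: Ladd cp(3))
    next
      fix w assume "w \<in> ?W"
      \<comment> \<open>Coordinate 1 is the least possible in the interior. In any decomposition the
        generator has coordinate at least 1 and the other summand at least 0, so the generator has
        exactly 1 and belongs to \<open>?D\<close>.\<close>
      then have "L (w, 1) \<in> ?W'" unfolding W' by simp
      then obtain c' p' where cp': "c' \<in> C" "p' \<in> ?S'" "L (w, 1) = c' + p'" using C(4) by blast
      obtain c m where c: "c' = L (c, m)" using cp'(1) CW W'_cases by (meson subsetD)
      obtain p k where p: "p' = L (p, k)" using cp'(2) S'_cases by meson
      have "L (c, m) \<in> ?W'" using cp'(1) CW unfolding c by blast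
      then have "1 \<le> m" using Ints_pos unfolding W' by simp
      moreover have "p \<in> ?S" "0 \<le> k" using cp'(2) unfolding p S' by simp_all
      moreover have "w = c + p" "1 = m + k"
        using cp'(3) unfolding c p Ladd Lcancel by simp_all
      moreover from calculation have "m = 1" by linarith
      ultimately have "c \<in> ?D" "p \<in> ?S" "w = c + p" using cp'(1) c by simp_all
      then show "w \<in> (\<Union>c\<in>?D. (+) c ` ?S)" by blast
    qed
    moreover have "finite ?D"
      using C(1) by (intro finite_vimageI injI) (simp_all add: Lcancel)
    moreover have "?D \<subseteq> lattice_points" using C(2) lattice by blast
    moreover have "\<forall>c\<in>?D. snd c = d - 1"
      using C(3) degree by (metis add_diff_cancel_right' vimageD)
    ultimately show "\<exists>C d. finite C \<and> C \<subseteq> lattice_points \<and> (\<forall>c\<in>C. snd c = d) \<and>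
        (\<Union>c\<in>C. (+) c ` ?S) = ?W"
      by blast
  qed
qed

section \<open>The change of coordinates for the sequence \<open>(1, s)\<close>\<close>

text \<open>This adds \<open>m\<close> times the vector \<open>(1, s, 1)\<close>, which is the
  vertex of the larger polytope with all ratios equal to 1, lifted to height 1. It is thus the
  inverse of the subtraction described at the outset.\<close>

definition shear ::
  "('n \<Rightarrow> nat) \<Rightarrow> ((real ^ 'n) \<times> real) \<times> real \<Rightarrow> (real ^ 'n option) \<times> real" where
  "shear s = (\<lambda>((x, t), m).
     (\<chi> i. case i of None \<Rightarrow> m | Some j \<Rightarrow> x $ j + m * real (s j), t + m))"

lemma linear_shear: "linear (shear s)"
proof (rule linearI)
  show "shear s (p + q) = shear s p + shear s q" for p q
    by (cases p; cases q)
      (auto simp: shear_def split_beta vec_eq_iff algebra_simps split: option.split)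
  show "shear s (c *\<^sub>R p) = c *\<^sub>R shear s p" for c p
    by (cases p)
      (auto simp: shear_def split_beta vec_eq_iff algebra_simps split: option.split)
qed

lemma inj_shear: "inj (shear s)"
proof (rule injI)
  fix p q assume eq: "shear s p = shear s q"
  obtain x t m where p: "p = ((x, t), m)" by (metis prod.exhaust)
  obtain y u k where q: "q = ((y, u), k)" by (metis prod.exhaust)
  have "fst (shear s p) $ i = fst (shear s q) $ i" for i using eq by simp
  from this[of None] this[of "Some j" for j] have "m = k" "x $ j = y $ j" for j
    by (simp_all add: p q shear_def)
  moreover have "t + m = u + k" using arg_cong[OF eq, of snd] by (simp add: p q shear_def)
  ultimately show "p = q" by (simp add: p q vec_eq_iff)
qed

text \<open>The coordinate \<open>None\<close> exhibits \<open>m\<close> itself; once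
  \<open>m\<close> is an integer, all other coordinates are shifted by integers because the
  \<open>s j\<close> are integers.\<close>

lemma shear_lattice_points:
  "shear s (p, m) \<in> lattice_points \<longleftrightarrow> p \<in> lattice_points \<and> m \<in> \<int>"
proof -
  obtain x t where p: "p = (x, t)" by (cases p)
  have iff: "a + b \<in> \<int> \<longleftrightarrow> a \<in> \<int>" if "b \<in> \<int>" for a b :: real
    using that Ints_add Ints_diff[of "a + b" b] by auto
  have all: "(\<forall>i. f i) \<longleftrightarrow> f None \<and> (\<forall>j. f (Some j))" for f :: "'a option \<Rightarrow> bool"
    by (metis option.exhaust)
  show ?thesis
    unfolding p shear_def lattice_points_def all by (auto simp: iff)
qed

text \<open>The shear adds \<open>m\<close> to every old ratio and to the height, while the new
  ratio is \<open>m / 1\<close>. Cancelling \<open>m\<close> from the inequalities leaves those for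
  \<open>s\<close> together with \<open>0 \<le> m\<close>.\<close>

lemma cone_over_cons_seq_1:
  fixes s :: "'n::{finite,linorder} \<Rightarrow> nat"
  assumes s: "\<And>i. s i \<ge> 1"
  shows "cone_over (lecture_hall_polytope (cons_seq 1 s)) =
    shear s ` (cone_over (lecture_hall_polytope s) \<times> {0..})"
proof -
  have all: "(\<forall>i. f i) \<longleftrightarrow> f None \<and> (\<forall>j. f (Some j))" for f :: "'n option \<Rightarrow> bool"
    by (metis option.exhaust)
  have s': "cons_seq 1 s i \<ge> 1" for i
    using s by (cases i) (auto simp: cons_seq_def)
  have nz: "s i \<noteq> 0" for i using s[of i] by simp
  have mem: "shear s (p, m) \<in> cone_over (lecture_hall_polytope (cons_seq 1 s)) \<longleftrightarrow>
      p \<in> cone_over (lecture_hall_polytope s) \<and> 0 \<le> m" for p m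
  proof -
    obtain x t where p: "p = (x, t)" by (cases p)
    have div: "(x $ j + m * real (s j)) / real (s j) = x $ j / real (s j) + m" for j
      using nz[of j] by (simp add: add_divide_distrib)
    \<comment> \<open>The upper bound at \<open>None\<close> reads \<open>m \<le> t + m\<close>,
      which is not listed among the inequalities for \<open>s\<close> but follows from them.\<close>
    have "0 \<le> t" if "\<forall>i. 0 \<le> x $ i / real (s i)" "\<forall>i. x $ i / real (s i) \<le> t"
      using that order_trans by blast
    then show ?thesis
      unfolding p cone_over_lecture_hall_polytope[OF s'] cone_over_lecture_hall_polytope[OF s]
      by (auto simp: all shear_def cons_seq_def div)
  qed
  \<comment> \<open>\<open>mem\<close> only speaks of points in the range of the shear; surjectivity
    extends it to the whole space.\<close>
  have "q \<in> range (shear s)" for q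
  proof -
    obtain y u where q: "q = (y, u)" by (cases q)
    have "q = shear s ((\<chi> j. y $ Some j - y $ None * real (s j), u - y $ None), y $ None)"
      by (simp add: q shear_def vec_eq_iff split: option.splits)
    then show ?thesis by blast
  qed
  then show ?thesis
    using mem by (fastforce simp: image_iff)
qed

theorem corollary24:
  fixes s :: "'n::{finite,linorder} \<Rightarrow> nat"
  assumes "\<And>i. s i \<ge> 1"
  shows "level TYPE('k::{alg_closed_field,field_char_0}) (lecture_hall_polytope s) \<longleftrightarrow>
         level TYPE('k) (lecture_hall_polytope (cons_seq 1 s))"
proof (rule level_iff_level_of_cone_times_halfline[where L = "shear s"])
  have s': "cons_seq 1 s i \<ge> 1" for i
    using assms by (cases i) (auto simp: cons_seq_def)
  show "bounded (lecture_hall_polytope s)" "bounded (lecture_hall_polytope (cons_seq 1 s))"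
    using compact_lecture_hall_polytope[of s] compact_lecture_hall_polytope[of "cons_seq 1 s"]
      assms s' compact_imp_bounded by blast+
  show "snd (shear s (p, m)) = snd p + m" for p m
    by (cases p) (simp add: shear_def)
  show "cone_over (lecture_hall_polytope (cons_seq 1 s)) =
      shear s ` (cone_over (lecture_hall_polytope s) \<times> {0..})"
    by (rule cone_over_cons_seq_1[OF assms])
qed (rule linear_shear inj_shear shear_lattice_points)+

end
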